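(* Let $T\in\mathbb{R}$, $\mathcal D=(-\infty,T]$, and let $u(s)=\int_{-\infty}^s G(s-t)\,\mathcal M(\mathrm dt)$, $s\in(-\infty,T]$, be a well-defined one-sided moving average process. Suppose that (i) $G:\mathbb{R}_+\to\mathbb{R}_+$ is non-negative, continuous and strictly decreasing; (ii) there is $\beta>0$ such that for any bounded Borel set $B\subset\mathcal D$ of positive Lebesgue measure, the random variable $\mathcal M(B)$ has an absolutely continuous distribution function $F_{\mathcal M(B)}$ with exponential tail $\bar F_{\mathcal M(B)}\in\mathscr L_\beta$. Let $s_1<s_2\le T$, $h=|s_1-s_2|$, and for $n$ with $-n<s_1$ let $u_n$ be the integral approximation of $u$ based on a partition $M_n=\{t_i,\ i=0,\dots,m_n\}$ of $[-n,T]$ (as described in the context). Let $\eta_n(h)$ be the residual tail dependence coefficient of $(u_n(s_1),u_n(s_2))$. If $m_n\to\infty$ and the sequence of mesh nodes $M_n$ is dense in $\mathcal D$, then the limit of $\eta_n(h)$ as $n\to\infty$ is $$\eta(h)=\frac{1}{2-G(h)/G(0)}.$$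
   Context: Exponential tails: for a distribution function $F$, $\bar F=1-F$. A function $g:\mathbb{R}\to\mathbb{R}_+$ with $\lim_{x\to\infty}g(x)=0$ belongs to $\mathscr L_\beta$ if $\lim_{x\to\infty}g(x-t)/g(x)=\exp(t\beta)$ for all $t\in\mathbb{R}$. Moving average process: $\mathcal M$ is an independently scattered random measure (its values on disjoint bounded Borel sets are independent), and the kernel is assumed $\mathcal M$-integrable, so that $u(s)$ is well defined as a limit in probability of integrals of simple functions. Integral approximation: let $-n=t_0<\cdots<t_{n_1}\le s_1<\cdots\le t_{n_2}\le s_2<\cdots<t_{m_n}=T$ be an arbitrary partition of $[-n,T]$ (the points depend on $n$; $t_{n_r}$ is the largest partition point not exceeding $s_r$). Then $$u_n(s_1)=\sum_{i=0}^{n_1-1}G(s_1-t_i)\,\mathcal M([t_i,t_{i+1})),\qquad u_n(s_2)=\sum_{i=0}^{n_2-1}G(s_2-t_i)\,\mathcal M([t_i,t_{i+1})).$$ The sequence $M_n$ is dense in $\mathcal D$ if for any $s\in\mathcal D$ there is a sequence $\bar a_n\in M_n$ with $\lim_{n\to\infty}|\bar a_n-s|=0$. Residual tail dependence coefficient: for a random vector $(X_1,X_2)$ with marginal distribution functions $F_{X_1},F_{X_2}$, $\eta=\lim_{q\uparrow1}\log(1-q)/\log\Pr(F_{X_1}(X_1)>q,F_{X_2}(X_2)>q)$, provided the limit exists. *)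

theory Defs
  imports "HOL-Probability.Probability"
begin

definition exp_tail_class :: "real \<Rightarrow> (real \<Rightarrow> real) set" where
  "exp_tail_class \<beta> = {g. (\<forall>x. 0 \<le> g x) \<and> (g \<longlongrightarrow> 0) at_top \<and>
     (\<forall>t. ((\<lambda>x. g (x - t) / g x) \<longlongrightarrow> exp (t * \<beta>)) at_top)}"

abbreviation distr_fun :: "'a measure \<Rightarrow> ('a \<Rightarrow> real) \<Rightarrow> real \<Rightarrow> real" where
  "distr_fun P X \<equiv> cdf (distr P borel X)"

definition tends_in_prob :: "'a measure \<Rightarrow> (nat \<Rightarrow> 'a \<Rightarrow> real) \<Rightarrow> ('a \<Rightarrow> real) \<Rightarrow> bool" where
  "tends_in_prob P X Y \<longleftrightarrow>
     (\<forall>k. X k \<in> borel_measurable P) \<and> Y \<in> borel_measurable P \<and>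
     (\<forall>\<epsilon>>0. (\<lambda>k. measure P {\<omega> \<in> space P. \<bar>X k \<omega> - Y \<omega>\<bar> > \<epsilon>}) \<longlonglongrightarrow> 0)"

definition bounded_borel :: "real set \<Rightarrow> real set set" where
  "bounded_borel D = {B. B \<in> sets borel \<and> bounded B \<and> B \<subseteq> D}"

text \<open>
  A random measure on \<^term>\<open>D\<close> is only given on the bounded Borel subsets of \<^term>\<open>D\<close>
  (a delta-ring). Countable additivity holds almost surely, with an exceptional set that may
  depend on the sequence of sets.
\<close>

definition indep_scattered_random_measure ::
    "'a measure \<Rightarrow> real set \<Rightarrow> (real set \<Rightarrow> 'a \<Rightarrow> real) \<Rightarrow> bool" where
  "indep_scattered_random_measure P D M \<longleftrightarrow>
     (\<forall>B \<in> bounded_borel D. M B \<in> borel_measurable P) \<and>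
     (\<forall>B :: nat \<Rightarrow> real set. range B \<subseteq> bounded_borel D \<longrightarrow> disjoint_family B \<longrightarrow>
        prob_space.indep_vars P (\<lambda>_. borel) (\<lambda>i. M (B i)) UNIV \<and>
        ((\<Union>i. B i) \<in> bounded_borel D \<longrightarrow>
           (AE \<omega> in P. (\<lambda>i. M (B i) \<omega>) sums M (\<Union>i. B i) \<omega>)))"

definition simple_integrand :: "real set \<Rightarrow> (real \<Rightarrow> real) \<Rightarrow> bool" where
  "simple_integrand D f \<longleftrightarrow> simple_function borel f \<and> {t. f t \<noteq> 0} \<in> bounded_borel D"

definition simple_M_integral ::
    "(real set \<Rightarrow> 'a \<Rightarrow> real) \<Rightarrow> real set \<Rightarrow> (real \<Rightarrow> real) \<Rightarrow> 'a \<Rightarrow> real" where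
  "simple_M_integral M A f \<omega> = (\<Sum>x \<in> range f - {0}. x * M (A \<inter> f -` {x}) \<omega>)"

text \<open>
  The null sets of the random measure itself; for an infinitely divisible random measure these
  are the null sets of its control measure.
\<close>

definition M_null :: "'a measure \<Rightarrow> real set \<Rightarrow> (real set \<Rightarrow> 'a \<Rightarrow> real) \<Rightarrow> real set \<Rightarrow> bool" where
  "M_null P D M N \<longleftrightarrow> N \<in> sets borel \<and> N \<subseteq> D \<and> (\<forall>B \<in> bounded_borel N. AE \<omega> in P. M B \<omega> = 0)"

text \<open>
  \<^term>\<open>f\<close> is integrable over \<^term>\<open>D\<close> with respect to the random measure \<^term>\<open>M\<close> with
  integral \<^term>\<open>X\<close>: some sequence of simple functions converges to \<^term>\<open>f\<close> almost everywhere,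
  its integrals over every Borel subset of \<^term>\<open>D\<close> converge in probability, and \<^term>\<open>X\<close> is
  the limit for \<^term>\<open>D\<close> itself.
\<close>

definition has_M_integral ::
    "'a measure \<Rightarrow> real set \<Rightarrow> (real set \<Rightarrow> 'a \<Rightarrow> real) \<Rightarrow> (real \<Rightarrow> real) \<Rightarrow> ('a \<Rightarrow> real) \<Rightarrow> bool" where
  "has_M_integral P D M f X \<longleftrightarrow>
     (\<exists>\<phi> :: nat \<Rightarrow> real \<Rightarrow> real.
        (\<forall>k. simple_integrand D (\<phi> k)) \<and>
        (\<exists>N. M_null P D M N \<and> (\<forall>t \<in> D - N. (\<lambda>k. \<phi> k t) \<longlonglongrightarrow> f t)) \<and>
        (\<forall>A \<in> sets borel. A \<subseteq> D \<longrightarrow> (\<exists>Y. tends_in_prob P (\<lambda>k. simple_M_integral M A (\<phi> k)) Y)) \<and>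
        tends_in_prob P (\<lambda>k. simple_M_integral M D (\<phi> k)) X)"

definition moving_average ::
    "'a measure \<Rightarrow> real set \<Rightarrow> (real set \<Rightarrow> 'a \<Rightarrow> real) \<Rightarrow> (real \<Rightarrow> real) \<Rightarrow> (real \<Rightarrow> 'a \<Rightarrow> real) \<Rightarrow> bool" where
  "moving_average P D M G u \<longleftrightarrow>
     (\<forall>s \<in> D. has_M_integral P D M (\<lambda>t. if t \<le> s then G (s - t) else 0) (u s))"

definition is_partition :: "real \<Rightarrow> real \<Rightarrow> nat \<Rightarrow> (nat \<Rightarrow> real) \<Rightarrow> bool" where
  "is_partition a b m t \<longleftrightarrow> t 0 = a \<and> t m = b \<and> strict_mono_on {..m} t"

definition last_node :: "nat \<Rightarrow> (nat \<Rightarrow> real) \<Rightarrow> real \<Rightarrow> nat" where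
  "last_node m t s = Max {i. i \<le> m \<and> t i \<le> s}"

definition integral_approx ::
    "(real set \<Rightarrow> 'a \<Rightarrow> real) \<Rightarrow> (real \<Rightarrow> real) \<Rightarrow> nat \<Rightarrow> (nat \<Rightarrow> real) \<Rightarrow> real \<Rightarrow> 'a \<Rightarrow> real" where
  "integral_approx M G m t s \<omega> =
     (\<Sum>i < last_node m t s. G (s - t i) * M {t i ..< t (Suc i)} \<omega>)"

definition has_residual_tail_coeff ::
    "'a measure \<Rightarrow> ('a \<Rightarrow> real) \<Rightarrow> ('a \<Rightarrow> real) \<Rightarrow> real \<Rightarrow> bool" where
  "has_residual_tail_coeff P X1 X2 \<eta> \<longleftrightarrow>
     ((\<lambda>q. ln (1 - q) /
        ln (measure P {\<omega> \<in> space P. distr_fun P X1 (X1 \<omega>) > q \<and> distr_fun P X2 (X2 \<omega>) > q}))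
      \<longlongrightarrow> \<eta>) (at_left 1)"

text \<open>
  Only meaningful when the limit exists.
\<close>

definition residual_tail_coeff :: "'a measure \<Rightarrow> ('a \<Rightarrow> real) \<Rightarrow> ('a \<Rightarrow> real) \<Rightarrow> real" where
  "residual_tail_coeff P X1 X2 = (THE \<eta>. has_residual_tail_coeff P X1 X2 \<eta>)"

end

(*
Write Z_i for the independent increments. Membership in the exponential class gives
P(Z_i > x) = exp(-(beta + o(1)) x), and the residual coefficient only sees logarithms of
probabilities, so these rates suffice. Exceeding large levels by nonnegative combinations of
the Z_i then becomes a linear program: reaching Z_i = z_i costs beta * z_i for z_i >= 0.
For u_n(s_1) alone the optimum uses the last node t_K before t_{n_1}, which has the largest
coefficient; similarly t_J for u_n(s_2). For both levels at once the optimum first uses t_K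
and then tops up with t_J, at relative cost 2 - G(s_2 - t_K) / G(s_2 - t_J). Its primal solution
gives the lower bound by independence, its dual solution the upper bound by Chernoff's inequality.
Density of the nodes moves t_K to s_1 and t_J to s_2.
*)
theory Submission
  imports Defs
begin

text \<open>Nothing is known about the left tails of the increments, so only right tails may be
  used. In upper bounds negative values are harmless, since exp(\<theta> z) <= 1 for z <= 0; in
  lower bounds every increment is forced to be positive, which costs only a constant factor. The
  residual coefficient refers to the marginal distribution functions, the linear program to explicit
  levels. They are matched by trapping both marginal quantiles at q: with a and b the coefficients
  of the two sums, they are roughly a_K x and b_J x with the same x = -ln(1 - q) / \<beta>, because
  each sum is governed by its largest coefficient. This common x is why the joint bounds have a
  single parameter. The o(1) in the rates is replaced by fixed rates \<beta> s and \<beta> / s with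
  s < 1. One rate enters through the quantiles and the other through the joint tail, so the loss is
  a factor s^2, which disappears as s tends to 1. The two optimal nodes must be distinct, which is
  why a node strictly between s_1 and s_2 is needed and the coefficient is computed for large n
  only.\<close>

section \<open>Exponential bounds for functions in the tail class\<close>

text \<open>Shift 0 is the informative one: the ratio of \<open>g x\<close> to itself tends to 1,
  whereas division by zero would give 0. So \<open>g\<close> is nonzero at arbitrarily large
  arguments, and monotonicity carries this to the left.\<close>

lemma exp_tail_pos:
  assumes "g \<in> exp_tail_class \<beta>" "antimono g"
  shows "g x > 0"
proof -
  have "((\<lambda>x. g (x - 0) / g x) \<longlongrightarrow> exp (0 * \<beta>)) at_top"
    using assms(1) unfolding exp_tail_class_def by blast
  then have "eventually (\<lambda>x. g (x - 0) / g x > 0) at_top"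
    by (rule order_tendstoD) simp
  then obtain y where "y \<ge> x" "g (y - 0) / g y > 0"
    by (auto simp: eventually_at_top_linorder) (meson linorder_le_cases)
  moreover have "g y \<ge> 0" using assms(1) unfolding exp_tail_class_def by auto
  moreover have "g y \<le> g x" using assms(2) \<open>y \<ge> x\<close> by (auto dest: antimonoD)
  ultimately show ?thesis by (cases "g y = 0") auto
qed

text \<open>Unit shifts suffice: for large x the ratio \<open>g (x - 1) / g x\<close> exceeds
  \<open>exp \<theta>\<close>, so \<open>g x * exp (\<theta> * x)\<close> does not grow from x - 1
  to x. On the initial stretch up to \<open>N\<close> monotonicity bounds it.\<close>

lemma exp_tail_upper:
  assumes "g \<in> exp_tail_class \<beta>" "antimono g" "0 < \<theta>" "\<theta> < \<beta>"
  shows "\<exists>C>0. \<forall>x\<ge>0. g x \<le> C * exp (- \<theta> * x)"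
proof -
  note pos = exp_tail_pos[OF assms(1,2)]
  have "((\<lambda>x. g (x - 1) / g x) \<longlongrightarrow> exp (1 * \<beta>)) at_top"
    using assms(1) unfolding exp_tail_class_def by blast
  then have "eventually (\<lambda>x. g (x - 1) / g x > exp \<theta>) at_top"
    by (rule order_tendstoD) (use assms in simp)
  then obtain N0 where N0: "\<And>x. x \<ge> N0 \<Longrightarrow> g (x - 1) / g x > exp \<theta>"
    by (auto simp: eventually_at_top_linorder)
  define N where "N = max N0 1"
  define h where "h x = g x * exp (\<theta> * x)" for x
  have step: "h x \<le> h (x - 1)" if "x \<ge> N" for x
  proof -
    have "exp \<theta> * g x \<le> g (x - 1)"
      using N0[of x] that pos[of x] unfolding N_def by (simp add: field_simps)
    then have "exp \<theta> * g x * exp (\<theta> * (x - 1)) \<le> g (x - 1) * exp (\<theta> * (x - 1))"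
      by (rule mult_right_mono) simp
    moreover have "exp \<theta> * g x * exp (\<theta> * (x - 1)) = h x"
      by (simp add: h_def algebra_simps flip: exp_add)
    ultimately show ?thesis by (simp add: h_def)
  qed
  define C where "C = g 0 * exp (\<theta> * N)"
  \<comment> \<open>Induction over strips of unit length. Since \<open>N \<ge> 1\<close>, a point
    beyond \<open>N\<close> stays nonnegative when moved back by 1.\<close>
  have "\<forall>x. 0 \<le> x \<and> x \<le> N + real n \<longrightarrow> h x \<le> C" for n
  proof (induction n)
    case 0
    have "g x * exp (\<theta> * x) \<le> g 0 * exp (\<theta> * N)" if "0 \<le> x" "x \<le> N" for x
      using assms that pos[of 0] by (intro mult_mono antimonoD[OF assms(2)]) auto
    then show ?case by (simp add: h_def C_def)
  next
    case (Suc n)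
    show ?case
    proof (intro allI impI)
      fix x assume x: "0 \<le> x \<and> x \<le> N + real (Suc n)"
      show "h x \<le> C"
      proof (cases "x \<ge> N")
        case True
        then have "h (x - 1) \<le> C" using Suc x by (auto simp: N_def)
        then show ?thesis using step[OF True] by simp
      next
        case False
        then show ?thesis using Suc x by simp
      qed
    qed
  qed
  then have "h x \<le> C" if "x \<ge> 0" for x
    using that real_arch_simple[of "x - N"] by (metis add.commute diff_le_eq)
  then have "g x \<le> C * exp (- \<theta> * x)" if "x \<ge> 0" for x
    using that by (simp add: h_def exp_minus divide_simps)
  moreover have "C > 0" using pos[of 0] by (simp add: C_def)
  ultimately show ?thesis by blast
qed

text \<open>Mirror image of the upper bound. The constant is \<open>g N\<close>, because on the
  stretch from 0 to \<open>N\<close> one has \<open>g x \<ge> g N\<close> and the exponential factor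
  is at least 1.\<close>

lemma exp_tail_lower:
  assumes "g \<in> exp_tail_class \<beta>" "antimono g" "0 < \<beta>" "\<beta> < \<theta>"
  shows "\<exists>c>0. \<forall>x\<ge>0. g x \<ge> c * exp (- \<theta> * x)"
proof -
  note pos = exp_tail_pos[OF assms(1,2)]
  have "((\<lambda>x. g (x - 1) / g x) \<longlongrightarrow> exp (1 * \<beta>)) at_top"
    using assms(1) unfolding exp_tail_class_def by blast
  then have "eventually (\<lambda>x. g (x - 1) / g x < exp \<theta>) at_top"
    by (rule order_tendstoD) (use assms in simp)
  then obtain N0 where N0: "\<And>x. x \<ge> N0 \<Longrightarrow> g (x - 1) / g x < exp \<theta>"
    by (auto simp: eventually_at_top_linorder)
  define N where "N = max N0 1"
  define h where "h x = g x * exp (\<theta> * x)" for x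
  have step: "h x \<ge> h (x - 1)" if "x \<ge> N" for x
  proof -
    have "exp \<theta> * g x \<ge> g (x - 1)"
      using N0[of x] that pos[of x] unfolding N_def by (simp add: field_simps)
    then have "exp \<theta> * g x * exp (\<theta> * (x - 1)) \<ge> g (x - 1) * exp (\<theta> * (x - 1))"
      by (rule mult_right_mono) simp
    moreover have "exp \<theta> * g x * exp (\<theta> * (x - 1)) = h x"
      by (simp add: h_def algebra_simps flip: exp_add)
    ultimately show ?thesis by (simp add: h_def)
  qed
  have "\<forall>x. 0 \<le> x \<and> x \<le> N + real n \<longrightarrow> h x \<ge> g N" for n
  proof (induction n)
    case 0
    have "g N * 1 \<le> g x * exp (\<theta> * x)" if "0 \<le> x" "x \<le> N" for x
      using assms that pos[of x]
      by (intro mult_mono antimonoD[OF assms(2)]) auto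
    then show ?case by (simp add: h_def)
  next
    case (Suc n)
    show ?case
    proof (intro allI impI)
      fix x assume x: "0 \<le> x \<and> x \<le> N + real (Suc n)"
      show "h x \<ge> g N"
      proof (cases "x \<ge> N")
        case True
        then have "h (x - 1) \<ge> g N" using Suc x by (auto simp: N_def)
        then show ?thesis using step[OF True] by simp
      next
        case False
        then show ?thesis using Suc x by simp
      qed
    qed
  qed
  then have "h x \<ge> g N" if "x \<ge> 0" for x
    using that real_arch_simple[of "x - N"] by (metis add.commute diff_le_eq)
  then have "g x \<ge> g N * exp (- \<theta> * x)" if "x \<ge> 0" for x
    using that by (simp add: h_def exp_minus divide_simps)
  then show ?thesis using pos[of N] by blast
qed

section \<open>Exponential moments and tails of weighted sums\<close>

text \<open>Cutting the positive values of \<open>Z\<close> into unit layers dominates the integral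
  by 1 plus a geometric series of ratio \<open>exp (\<theta> - \<theta>')\<close>.\<close>

lemma (in prob_space) nn_integral_exp_finite:
  assumes [measurable]: "Z \<in> borel_measurable M"
    and "0 < \<theta>" "\<theta> < \<theta>'" "0 < C"
    and tail: "\<And>x. x \<ge> 0 \<Longrightarrow> prob {\<omega> \<in> space M. Z \<omega> > x} \<le> C * exp (- \<theta>' * x)"
  shows "(\<integral>\<^sup>+\<omega>. ennreal (exp (\<theta> * Z \<omega>)) \<partial>M) < \<infinity>"
proof -
  define A where "A k = {\<omega> \<in> space M. Z \<omega> > real k}" for k
  have [measurable]: "A k \<in> sets M" for k unfolding A_def by measurable
  define c where "c k = exp (\<theta> * (real k + 1))" for k
  have pointwise: "ennreal (exp (\<theta> * Z \<omega>)) \<le> 1 + (\<Sum>k. ennreal (c k) * indicator (A k) \<omega>)"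
    if "\<omega> \<in> space M" for \<omega>
  proof (cases "Z \<omega> \<le> 0")
    case True
    then have "exp (\<theta> * Z \<omega>) \<le> 1" using \<open>0 < \<theta>\<close> by (simp add: mult_nonneg_nonpos)
    then have "ennreal (exp (\<theta> * Z \<omega>)) \<le> 1" by simp
    then show ?thesis by (simp add: add_increasing2)
  next
    case False
    \<comment> \<open>The layer is open on the left and closed on the right, to fit the strict
      inequality in \<open>A k\<close>.\<close>
    define k where "k = nat (\<lceil>Z \<omega>\<rceil>) - 1"
    have k: "real k < Z \<omega>" "Z \<omega> \<le> real k + 1" using False unfolding k_def by linarith+
    have "ennreal (exp (\<theta> * Z \<omega>)) \<le> ennreal (c k) * indicator (A k) \<omega>"
      using k that \<open>0 < \<theta>\<close> by (auto simp: A_def c_def intro!: ennreal_leI)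
    also have "\<dots> \<le> (\<Sum>k. ennreal (c k) * indicator (A k) \<omega>)"
      using sum_le_suminf[OF summableI, of "{k}" "\<lambda>k. ennreal (c k) * indicator (A k) \<omega>"]
      by (simp del: sum_mult_indicator)
    finally show ?thesis by (simp add: add_increasing)
  qed
  define r where "r = exp (\<theta> - \<theta>')"
  have r: "0 < r" "r < 1" using assms by (auto simp: r_def)
  have bound: "ennreal (c k) * emeasure M (A k) \<le> ennreal (C * exp \<theta> * r ^ k)" for k
  proof -
    have "c k * prob (A k) \<le> c k * (C * exp (- \<theta>' * real k))"
      using tail[of "real k"] by (intro mult_left_mono) (auto simp: A_def c_def)
    also have "\<dots> = C * exp \<theta> * r ^ k"
      by (simp add: c_def r_def algebra_simps flip: exp_add exp_of_nat_mult)
    finally have "ennreal (c k * prob (A k)) \<le> ennreal (C * exp \<theta> * r ^ k)"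
      by (rule ennreal_leI)
    then show ?thesis by (simp add: emeasure_eq_measure ennreal_mult'' c_def)
  qed
  have "(\<integral>\<^sup>+\<omega>. ennreal (exp (\<theta> * Z \<omega>)) \<partial>M) \<le>
      (\<integral>\<^sup>+\<omega>. 1 + (\<Sum>k. ennreal (c k) * indicator (A k) \<omega>) \<partial>M)"
    by (intro nn_integral_mono pointwise)
  also have "\<dots> = 1 + (\<Sum>k. ennreal (c k) * emeasure M (A k))"
    by (simp add: nn_integral_add nn_integral_suminf nn_integral_cmult emeasure_space_1)
  also have "\<dots> \<le> 1 + (\<Sum>k. ennreal (C * exp \<theta> * r ^ k))"
    by (intro add_left_mono suminf_le bound summableI)
  also have "(\<lambda>k. C * exp \<theta> * r ^ k) sums (C * exp \<theta> * (1 / (1 - r)))"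
    using r by (intro sums_mult geometric_sums) auto
  then have "(\<Sum>k. ennreal (C * exp \<theta> * r ^ k)) = ennreal (C * exp \<theta> * (1 / (1 - r)))"
    using r \<open>0 < C\<close> by (intro suminf_ennreal_eq) auto
  also have "1 + ennreal (C * exp \<theta> * (1 / (1 - r))) < \<infinity>" by simp
  finally show ?thesis .
qed

text \<open>Chernoff bound, with the exponential moment of the sum factored by independence. Weights
  in [0, 1] keep every factor finite: the integrand is dominated by
  \<open>1 + exp (\<theta> * z)\<close>, by sign preservation for negative z and by
  \<open>c i \<le> 1\<close> otherwise.\<close>

lemma (in prob_space) weighted_sum_tail_upper:
  assumes I: "finite I" and indep: "indep_vars (\<lambda>_. borel) Z I"
    and c: "\<And>i. i \<in> I \<Longrightarrow> 0 \<le> c i \<and> c i \<le> 1" and "0 < \<theta>"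
    and fin: "\<And>i. i \<in> I \<Longrightarrow> (\<integral>\<^sup>+\<omega>. ennreal (exp (\<theta> * Z i \<omega>)) \<partial>M) < \<infinity>"
  shows "\<exists>C>0. \<forall>x. prob {\<omega> \<in> space M. (\<Sum>i\<in>I. c i * Z i \<omega>) \<ge> x} \<le> C * exp (- \<theta> * x)"
proof -
  have Z[measurable]: "\<And>i. i \<in> I \<Longrightarrow> Z i \<in> borel_measurable M"
    using indep by (auto simp: indep_vars_def2)
  define S where "S \<omega> = (\<Sum>i\<in>I. c i * Z i \<omega>)" for \<omega>
  have [measurable]: "S \<in> borel_measurable M" unfolding S_def by measurable
  have single: "(\<integral>\<^sup>+\<omega>. ennreal (exp (\<theta> * (c i * Z i \<omega>))) \<partial>M) < \<infinity>" if i: "i \<in> I" for i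
  proof -
    note Z[OF i, measurable]
    have "exp (\<theta> * (c i * z)) \<le> 1 + exp (\<theta> * z)" for z
    proof (cases "z \<ge> 0")
      case True
      then have "c i * z \<le> z" using c[OF i] by (simp add: mult_left_le_one_le)
      then have "exp (\<theta> * (c i * z)) \<le> exp (\<theta> * z)" using \<open>0 < \<theta>\<close> by simp
      then show ?thesis by (simp add: add_increasing)
    next
      case False
      then have "exp (\<theta> * (c i * z)) \<le> 1"
        using c[OF i] \<open>0 < \<theta>\<close> by (simp add: mult_nonneg_nonpos)
      then show ?thesis by (simp add: add_increasing2)
    qed
    then have "(\<integral>\<^sup>+\<omega>. ennreal (exp (\<theta> * (c i * Z i \<omega>))) \<partial>M) \<le>
        (\<integral>\<^sup>+\<omega>. 1 + ennreal (exp (\<theta> * Z i \<omega>)) \<partial>M)"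
      by (intro nn_integral_mono) (simp add: ennreal_leI flip: ennreal_1 ennreal_plus)
    also have "\<dots> = 1 + (\<integral>\<^sup>+\<omega>. ennreal (exp (\<theta> * Z i \<omega>)) \<partial>M)"
      by (simp add: nn_integral_add emeasure_space_1)
    also have "\<dots> < \<infinity>" using fin[OF i] by simp
    finally show ?thesis .
  qed
  have "(\<integral>\<^sup>+\<omega>. ennreal (exp (\<theta> * S \<omega>)) \<partial>M) =
      (\<integral>\<^sup>+\<omega>. (\<Prod>i\<in>I. ennreal (exp (\<theta> * (c i * Z i \<omega>)))) \<partial>M)"
    using I by (simp add: S_def sum_distrib_left exp_sum prod_ennreal)
  also have "\<dots> = (\<Prod>i\<in>I. \<integral>\<^sup>+\<omega>. ennreal (exp (\<theta> * (c i * Z i \<omega>))) \<partial>M)"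
    using I by (intro indep_vars_nn_integral indep_vars_compose2[OF indep]) auto
  also have "\<dots> < \<infinity>"
    using single by (auto simp: less_top[symmetric] ennreal_prod_eq_top)
  finally obtain K where K: "(\<integral>\<^sup>+\<omega>. ennreal (exp (\<theta> * S \<omega>)) \<partial>M) = ennreal K" "K \<ge> 0"
    by (cases rule: ennreal_cases[of "\<integral>\<^sup>+\<omega>. ennreal (exp (\<theta> * S \<omega>)) \<partial>M"]) auto
  \<comment> \<open>Passing from \<open>K\<close> to \<open>K + 1\<close> gives a positive constant
    without showing that \<open>K\<close> is positive.\<close>
  have "prob {\<omega> \<in> space M. S \<omega> \<ge> x} \<le> (K + 1) * exp (- \<theta> * x)" for x
  proof -
    have "emeasure M {\<omega> \<in> space M. S \<omega> \<ge> x} \<le>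
        ennreal (exp (- \<theta> * x)) * (\<integral>\<^sup>+\<omega>. ennreal (exp (\<theta> * S \<omega>)) * indicator (space M) \<omega> \<partial>M)"
      using \<open>0 < \<theta>\<close> by (intro Chernoff_ineq_nn_integral_ge) auto
    also have "\<dots> = ennreal (exp (- \<theta> * x) * K)"
      using K by (simp add: ennreal_mult' cong: nn_integral_cong)
    finally have "prob {\<omega> \<in> space M. S \<omega> \<ge> x} \<le> exp (- \<theta> * x) * K"
      using K(2) by (simp add: emeasure_eq_measure)
    then show ?thesis by (simp add: algebra_simps add_increasing)
  qed
  then show ?thesis unfolding S_def using K(2) by (intro exI[of _ "K + 1"]) auto
qed

lemma (in prob_space) indep_joint_tail:
  assumes "indep_vars (\<lambda>_. borel) Z I" "finite I" "I \<noteq> {}"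
  shows "prob {\<omega> \<in> space M. \<forall>i\<in>I. Z i \<omega> > v i} = (\<Prod>i\<in>I. prob {\<omega> \<in> space M. Z i \<omega> > (v i :: real)})"
proof -
  have "prob (\<Inter>i\<in>I. Z i -` {v i<..} \<inter> space M) = (\<Prod>i\<in>I. prob (Z i -` {v i<..} \<inter> space M))"
    using assms by (intro indep_varsD_finite[OF assms(1)]) auto
  moreover have "(\<Inter>i\<in>I. Z i -` {v i<..} \<inter> space M) = {\<omega> \<in> space M. \<forall>i\<in>I. Z i \<omega> > v i}"
    using assms by auto
  moreover have "Z i -` {v i<..} \<inter> space M = {\<omega> \<in> space M. Z i \<omega> > v i}" for i by auto
  ultimately show ?thesis by simp
qed

lemma (in prob_space) antimono_tail:
  assumes [measurable]: "Z \<in> borel_measurable M"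
  shows "antimono (\<lambda>x::real. prob {\<omega> \<in> space M. Z \<omega> > x})"
  by (rule antimonoI) (auto intro!: finite_measure_mono)

lemma (in prob_space) one_minus_distr_fun:
  assumes [measurable]: "X \<in> borel_measurable M"
  shows "1 - distr_fun M X x = prob {\<omega> \<in> space M. X \<omega> > x}"
proof -
  have "prob {\<omega> \<in> space M. \<not> X \<omega> \<le> x} = 1 - prob {\<omega> \<in> space M. X \<omega> \<le> x}"
    by (rule prob_neg) measurable
  moreover have "distr_fun M X x = prob {\<omega> \<in> space M. X \<omega> \<le> x}"
    by (auto simp: cdf_def measure_distr intro!: arg_cong[where f = prob])
  ultimately show ?thesis by (simp add: not_le)
qed

text \<open>One big summand suffices: \<open>Z K\<close> alone exceeds \<open>x / a K\<close>, while
  all others are merely positive. The latter has probability \<open>d\<close>, which does not depend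
  on x.\<close>

lemma (in prob_space) weighted_sum_tail_lower:
  assumes I: "finite I" "K \<in> I" and indep: "indep_vars (\<lambda>_. borel) Z I"
    and a: "\<And>i. i \<in> I \<Longrightarrow> 0 \<le> a i" "0 < a K"
    and tail: "\<And>i. i \<in> I \<Longrightarrow> (\<lambda>x. prob {\<omega> \<in> space M. Z i \<omega> > x}) \<in> exp_tail_class \<beta>"
    and "0 < \<beta>" "\<beta> < \<theta>"
  shows "\<exists>c>0. \<forall>x\<ge>0. prob {\<omega> \<in> space M. (\<Sum>i\<in>I. a i * Z i \<omega>) > x} \<ge> c * exp (- \<theta> * (x / a K))"
proof -
  have Z[measurable]: "\<And>i. i \<in> I \<Longrightarrow> Z i \<in> borel_measurable M"
    using indep by (auto simp: indep_vars_def2)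
  define p where "p i x = prob {\<omega> \<in> space M. Z i \<omega> > x}" for i x
  have p: "p i \<in> exp_tail_class \<beta>" "antimono (p i)" if "i \<in> I" for i
    using tail[OF that] antimono_tail[OF Z[OF that]] by (simp_all add: p_def[abs_def])
  obtain c where c: "c > 0" "\<And>x. x \<ge> 0 \<Longrightarrow> p K x \<ge> c * exp (- \<theta> * x)"
    using exp_tail_lower[OF p[OF \<open>K \<in> I\<close>] \<open>0 < \<beta>\<close> \<open>\<beta> < \<theta>\<close>] by blast
  define d where "d = (\<Prod>i\<in>I - {K}. p i 0)"
  have d: "d > 0" unfolding d_def using exp_tail_pos p by (intro prod_pos) blast
  have "prob {\<omega> \<in> space M. (\<Sum>i\<in>I. a i * Z i \<omega>) > x} \<ge> c * d * exp (- \<theta> * (x / a K))"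
    if x: "x \<ge> 0" for x
  proof -
    define v where "v i = (if i = K then x / a K else 0)" for i
    have "c * d * exp (- \<theta> * (x / a K)) \<le> p K (x / a K) * d"
      using c(2)[of "x / a K"] x a(2) d by (auto simp: mult.commute mult.left_commute)
    also have "\<dots> = (\<Prod>i\<in>I. p i (v i))"
      using I by (auto simp: prod.remove[of I K] d_def v_def intro!: prod.cong)
    also have "\<dots> = prob {\<omega> \<in> space M. \<forall>i\<in>I. Z i \<omega> > v i}"
      unfolding p_def using indep I by (subst indep_joint_tail) auto
    also have "\<dots> \<le> prob {\<omega> \<in> space M. (\<Sum>i\<in>I. a i * Z i \<omega>) > x}"
    proof (rule finite_measure_mono; safe?)
      fix \<omega> assume *: "\<forall>i\<in>I. Z i \<omega> > v i"
      have nonneg: "Z i \<omega> \<ge> 0" if "i \<in> I" for i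
      proof -
        have "v i \<ge> 0" using x a(2) by (simp add: v_def)
        then show ?thesis using *[rule_format, OF that] by linarith
      qed
      have "x < a K * Z K \<omega>"
        using * I a(2) by (auto simp: v_def field_simps)
      also have "\<dots> \<le> (\<Sum>i\<in>I. a i * Z i \<omega>)"
        using I a(1) nonneg by (intro member_le_sum) auto
      finally show "(\<Sum>i\<in>I. a i * Z i \<omega>) > x" .
    qed measurable
    finally show ?thesis .
  qed
  then show ?thesis using c(1) d by (intro exI[of _ "c * d"]) auto
qed

text \<open>An intermediate rate between \<open>\<theta>\<close> and \<open>\<beta>\<close> for the
  individual tails leaves the room that makes the moments of order \<open>\<theta>\<close>
  finite.\<close>

lemma (in prob_space) exp_tail_weighted_sum_upper:
  assumes I: "finite I" and indep: "indep_vars (\<lambda>_. borel) Z I"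
    and c: "\<And>i. i \<in> I \<Longrightarrow> 0 \<le> c i \<and> c i \<le> 1"
    and tail: "\<And>i. i \<in> I \<Longrightarrow> (\<lambda>x. prob {\<omega> \<in> space M. Z i \<omega> > x}) \<in> exp_tail_class \<beta>"
    and "0 < \<theta>" "\<theta> < \<beta>"
  shows "\<exists>C>0. \<forall>x. prob {\<omega> \<in> space M. (\<Sum>i\<in>I. c i * Z i \<omega>) \<ge> x} \<le> C * exp (- \<theta> * x)"
proof (rule weighted_sum_tail_upper[OF I indep c \<open>0 < \<theta>\<close>])
  fix i assume i: "i \<in> I"
  then have Z: "Z i \<in> borel_measurable M" using indep by (auto simp: indep_vars_def2)
  obtain \<theta>' where \<theta>': "\<theta> < \<theta>'" "\<theta>' < \<beta>" using dense[OF \<open>\<theta> < \<beta>\<close>] by blast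
  then obtain C where "C > 0" "\<forall>x\<ge>0. prob {\<omega> \<in> space M. Z i \<omega> > x} \<le> C * exp (- \<theta>' * x)"
    using exp_tail_upper[OF tail[OF i] antimono_tail[OF Z], of \<theta>'] \<open>0 < \<theta>\<close> by auto
  then show "(\<integral>\<^sup>+\<omega>. ennreal (exp (\<theta> * Z i \<omega>)) \<partial>M) < \<infinity>"
    using \<theta>' \<open>0 < \<theta>\<close> by (intro nn_integral_exp_finite[OF Z, of \<theta> \<theta>' C]) auto
qed

text \<open>Turns bounds with a fixed slack s into a limit: the additive constant, which may depend
  on s, is absorbed as \<open>L\<close> diverges, and then s is chosen close to 1.\<close>

lemma tendsto_ratio_by_factors:
  fixes L f :: "'b \<Rightarrow> real"
  assumes L: "filterlim L at_top F"
    and bounds: "\<And>s. 0 < s \<Longrightarrow> s < 1 \<Longrightarrow>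
      \<exists>k. \<forall>\<^sub>F q in F. \<rho> * s\<^sup>2 * L q - k \<le> f q \<and> f q \<le> \<rho> / s\<^sup>2 * L q + k"
  shows "((\<lambda>q. f q / L q) \<longlongrightarrow> \<rho>) F"
proof (rule order_tendstoI)
  have s01: "\<forall>\<^sub>F s in at_left (1::real). 0 < s \<and> s < 1"
    by (auto simp: eventually_at_left_field intro: exI[of _ 0])
  have pos: "\<forall>\<^sub>F q in F. L q > 0" using L by (simp add: filterlim_at_top_dense)
  show "\<forall>\<^sub>F q in F. y < f q / L q" if "y < \<rho>" for y
  proof -
    have "((\<lambda>s::real. \<rho> * s\<^sup>2) \<longlongrightarrow> \<rho> * 1\<^sup>2) (at_left 1)" by (intro tendsto_intros)
    then have "\<forall>\<^sub>F s in at_left 1. y < \<rho> * s\<^sup>2" using \<open>y < \<rho>\<close> by (intro order_tendstoD) auto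
    with s01 have "\<forall>\<^sub>F s in at_left (1::real). 0 < s \<and> s < 1 \<and> y < \<rho> * s\<^sup>2" by eventually_elim simp
    then obtain s where s: "0 < s" "s < 1" "y < \<rho> * s\<^sup>2"
      using eventually_happens'[OF trivial_limit_at_left_real] by blast
    from bounds[OF s(1,2)] obtain k where k: "\<forall>\<^sub>F q in F. \<rho> * s\<^sup>2 * L q - k \<le> f q"
      by (auto simp: eventually_conj_iff)
    have "\<forall>\<^sub>F q in F. L q > k / (\<rho> * s\<^sup>2 - y)" using L by (simp add: filterlim_at_top_dense)
    with k pos show ?thesis
    proof eventually_elim
      case (elim q)
      then have "k < (\<rho> * s\<^sup>2 - y) * L q" using s(3) by (simp add: pos_divide_less_eq mult.commute)
      then have "y * L q < f q" using elim by (simp add: algebra_simps)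
      then show ?case using elim by (simp add: pos_less_divide_eq)
    qed
  qed
  show "\<forall>\<^sub>F q in F. y > f q / L q" if "y > \<rho>" for y
  proof -
    have "((\<lambda>s::real. \<rho> / s\<^sup>2) \<longlongrightarrow> \<rho> / 1\<^sup>2) (at_left 1)" by (intro tendsto_intros) auto
    then have "\<forall>\<^sub>F s in at_left 1. y > \<rho> / s\<^sup>2" using \<open>y > \<rho>\<close> by (intro order_tendstoD) auto
    with s01 have "\<forall>\<^sub>F s in at_left (1::real). 0 < s \<and> s < 1 \<and> y > \<rho> / s\<^sup>2" by eventually_elim simp
    then obtain s where s: "0 < s" "s < 1" "y > \<rho> / s\<^sup>2"
      using eventually_happens'[OF trivial_limit_at_left_real] by blast
    from bounds[OF s(1,2)] obtain k where k: "\<forall>\<^sub>F q in F. f q \<le> \<rho> / s\<^sup>2 * L q + k"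
      by (auto simp: eventually_conj_iff)
    have "\<forall>\<^sub>F q in F. L q > k / (y - \<rho> / s\<^sup>2)" using L by (simp add: filterlim_at_top_dense)
    with k pos show ?thesis
    proof eventually_elim
      case (elim q)
      then have "k < (y - \<rho> / s\<^sup>2) * L q" using s(3) by (simp add: pos_divide_less_eq mult.commute)
      then have "y * L q > f q" using elim by (simp add: algebra_simps)
      then show ?case using elim by (simp add: pos_divide_less_eq)
    qed
  qed
qed

section \<open>Joint tails of two weighted sums: the linear program\<close>

lemma (in prob_space) joint_weighted_tail_lower:
  assumes I: "finite I" "K \<in> I" "J \<in> I" "K \<noteq> J" and indep: "indep_vars (\<lambda>_. borel) Z I"
    and a: "\<And>i. i \<in> I \<Longrightarrow> 0 \<le> a i" "0 < a K"
    and b: "\<And>i. i \<in> I \<Longrightarrow> 0 \<le> b i" "0 < b J" "b K \<le> b J"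
    and tail: "\<And>i. i \<in> I \<Longrightarrow> (\<lambda>x. prob {\<omega> \<in> space M. Z i \<omega> > x}) \<in> exp_tail_class \<beta>"
    and "0 < \<beta>" "\<beta> < \<theta>"
  shows "\<exists>c>0. \<forall>x\<ge>0. c * exp (- \<theta> * ((2 - b K / b J) * x)) \<le>
    prob {\<omega> \<in> space M. (\<Sum>i\<in>I. a i * Z i \<omega>) > a K * x \<and> (\<Sum>i\<in>I. b i * Z i \<omega>) > b J * x}"
proof -
  have Z[measurable]: "\<And>i. i \<in> I \<Longrightarrow> Z i \<in> borel_measurable M"
    using indep by (auto simp: indep_vars_def2)
  define p where "p i x = prob {\<omega> \<in> space M. Z i \<omega> > x}" for i x
  have p: "p i \<in> exp_tail_class \<beta>" "antimono (p i)" if "i \<in> I" for i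
    using tail[OF that] antimono_tail[OF Z[OF that]] by (simp_all add: p_def[abs_def])
  have "\<forall>i\<in>I. \<exists>c>0. \<forall>x\<ge>0. p i x \<ge> c * exp (- \<theta> * x)"
    using exp_tail_lower[OF p \<open>0 < \<beta>\<close> \<open>\<beta> < \<theta>\<close>] by blast
  then obtain c where c: "\<And>i. i \<in> I \<Longrightarrow> c i > 0"
      "\<And>i x. i \<in> I \<Longrightarrow> x \<ge> 0 \<Longrightarrow> p i x \<ge> c i * exp (- \<theta> * x)"
    by metis
  have "(\<Prod>i\<in>I. c i) * exp (- \<theta> * ((2 - b K / b J) * x)) \<le>
    prob {\<omega> \<in> space M. (\<Sum>i\<in>I. a i * Z i \<omega>) > a K * x \<and> (\<Sum>i\<in>I. b i * Z i \<omega>) > b J * x}"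
    if x: "x \<ge> 0" for x
  proof -
    \<comment> \<open>cheapest way to exceed both levels: \<^term>\<open>Z K\<close> carries the first sum, \<^term>\<open>Z J\<close> tops up the second\<close>
    define v where "v i = (if i = K then x else 0) + (if i = J then (1 - b K / b J) * x else 0)" for i
    have v: "v i \<ge> 0" for i using x b by (auto simp: v_def)
    \<comment> \<open>The total cost of the primal point. The exponential turns it into a product
      matching the independent factors.\<close>
    have "(\<Sum>i\<in>I. v i) = (2 - b K / b J) * x"
      using I by (simp add: v_def sum.distrib algebra_simps)
    moreover have "exp (- \<theta> * (\<Sum>i\<in>I. v i)) = (\<Prod>i\<in>I. exp (- \<theta> * v i))"
      using I(1) by (simp only: sum_distrib_left exp_sum)
    ultimately have "(\<Prod>i\<in>I. c i) * exp (- \<theta> * ((2 - b K / b J) * x)) = (\<Prod>i\<in>I. c i * exp (- \<theta> * v i))"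
      by (simp only: prod.distrib)
    also have "\<dots> \<le> (\<Prod>i\<in>I. p i (v i))"
      using c v by (intro prod_mono) (auto simp: less_imp_le)
    also have "\<dots> = prob {\<omega> \<in> space M. \<forall>i\<in>I. Z i \<omega> > v i}"
      unfolding p_def using indep I by (subst indep_joint_tail) auto
    also have "\<dots> \<le> prob {\<omega> \<in> space M. (\<Sum>i\<in>I. a i * Z i \<omega>) > a K * x \<and> (\<Sum>i\<in>I. b i * Z i \<omega>) > b J * x}"
    proof (rule finite_measure_mono; safe?)
      fix \<omega> assume *: "\<forall>i\<in>I. Z i \<omega> > v i"
      have nonneg: "Z i \<omega> \<ge> 0" if "i \<in> I" for i
        using *[rule_format, OF that] v[of i] by linarith
      have K: "x < Z K \<omega>" and J: "(1 - b K / b J) * x < Z J \<omega>"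
        using *[rule_format, of K] *[rule_format, of J] I by (auto simp: v_def)
      have "a K * x < a K * Z K \<omega>" using K a(2) by simp
      also have "\<dots> \<le> (\<Sum>i\<in>I. a i * Z i \<omega>)"
        using I a(1) nonneg by (intro member_le_sum) auto
      finally show "(\<Sum>i\<in>I. a i * Z i \<omega>) > a K * x" .
      \<comment> \<open>\<open>Z K\<close> already contributes \<open>b K * x\<close> to the second
        sum, and the rest is left to \<open>Z J\<close>. Strictness must come from the J term, since
        \<open>b K\<close> may be 0.\<close>
      have "b J * x = b K * x + b J * ((1 - b K / b J) * x)"
        using b(2) by (simp add: field_simps)
      also have "\<dots> < b K * Z K \<omega> + b J * Z J \<omega>"
        using K J b I by (intro add_le_less_mono mult_left_mono mult_strict_left_mono) auto
      also have "\<dots> = (\<Sum>i\<in>{K, J}. b i * Z i \<omega>)" using I by simp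
      also have "\<dots> \<le> (\<Sum>i\<in>I. b i * Z i \<omega>)"
        using I b(1) nonneg by (intro sum_mono2) auto
      finally show "(\<Sum>i\<in>I. b i * Z i \<omega>) > b J * x" .
    qed measurable
    finally show ?thesis .
  qed
  then show ?thesis using c(1) by (intro exI[of _ "\<Prod>i\<in>I. c i"]) (auto intro!: prod_pos)
qed

lemma (in prob_space) joint_weighted_tail_upper:
  assumes I: "finite I" and indep: "indep_vars (\<lambda>_. borel) Z I"
    and a: "\<And>i. i \<in> I \<Longrightarrow> 0 \<le> a i \<and> a i \<le> a K" "0 < a K"
    and b: "\<And>i. i \<in> I \<Longrightarrow> 0 \<le> b i \<and> b i \<le> b J" "0 < b J" "b K \<le> b J"
    and ab: "\<And>i. i \<in> I \<Longrightarrow> a i \<noteq> 0 \<Longrightarrow> b i \<le> b K"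
    and tail: "\<And>i. i \<in> I \<Longrightarrow> (\<lambda>x. prob {\<omega> \<in> space M. Z i \<omega> > x}) \<in> exp_tail_class \<beta>"
    and "0 < \<theta>" "\<theta> < \<beta>"
  shows "\<exists>C>0. \<forall>x.
    prob {\<omega> \<in> space M. (\<Sum>i\<in>I. a i * Z i \<omega>) \<ge> a K * x \<and> (\<Sum>i\<in>I. b i * Z i \<omega>) \<ge> b J * x} \<le>
    C * exp (- \<theta> * ((2 - b K / b J) * x))"
proof -
  have Z[measurable]: "\<And>i. i \<in> I \<Longrightarrow> Z i \<in> borel_measurable M"
    using indep by (auto simp: indep_vars_def2)
  \<comment> \<open>optimal dual weights of the linear program minimizing the cost \<open>\<Sum>i\<in>I. z i\<close> subject to
    \<open>(\<Sum>i\<in>I. a i * z i) \<ge> a K\<close>, \<open>(\<Sum>i\<in>I. b i * z i) \<ge> b J\<close> and \<open>z \<ge> 0\<close>\<close>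
  define y1 where "y1 = (1 - b K / b J) / a K"
  define y2 where "y2 = 1 / b J"
  have y: "y1 \<ge> 0" "y2 \<ge> 0" using a b by (auto simp: y1_def y2_def)
  define c where "c i = y1 * a i + y2 * b i" for i
  have c: "0 \<le> c i \<and> c i \<le> 1" if i: "i \<in> I" for i
  proof
    show "0 \<le> c i" using y a(1)[OF i] b(1)[OF i] by (simp add: c_def)
    show "c i \<le> 1"
    \<comment> \<open>Dual feasibility. A variable absent from the first sum is controlled by
      \<open>b i \<le> b J\<close>; one that is present satisfies \<open>b i \<le> b K\<close> by
      \<open>ab\<close>, so its constraint is no worse than that of K, which is tight.\<close>
    proof (cases "a i = 0")
      case True
      then show ?thesis using b(1)[OF i] b(2) by (simp add: c_def y2_def)
    next
      case False
      have "y1 * a i \<le> y1 * a K" using y a(1)[OF i] by (intro mult_left_mono) auto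
      moreover have "y2 * b i \<le> y2 * b K" using y ab[OF i False] by (intro mult_left_mono) auto
      moreover have "y1 * a K + y2 * b K = 1" using a(2) b(2) by (simp add: y1_def y2_def)
      ultimately show ?thesis by (simp add: c_def)
    qed
  qed
  obtain C where C: "C > 0"
      "\<And>x. prob {\<omega> \<in> space M. (\<Sum>i\<in>I. c i * Z i \<omega>) \<ge> x} \<le> C * exp (- \<theta> * x)"
  proof -
    have "\<exists>C>0. \<forall>x. prob {\<omega> \<in> space M. (\<Sum>i\<in>I. c i * Z i \<omega>) \<ge> x} \<le> C * exp (- \<theta> * x)"
      by (rule exp_tail_weighted_sum_upper[where \<beta> = \<beta>]; fact)
    then show ?thesis using that by blast
  qed
  \<comment> \<open>Weak duality, pointwise: only the dual weights need a sign, so negative values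
    of the \<open>Z i\<close> do no harm.\<close>
  have le: "prob {\<omega> \<in> space M. (\<Sum>i\<in>I. a i * Z i \<omega>) \<ge> a K * x \<and> (\<Sum>i\<in>I. b i * Z i \<omega>) \<ge> b J * x} \<le>
      prob {\<omega> \<in> space M. (\<Sum>i\<in>I. c i * Z i \<omega>) \<ge> (2 - b K / b J) * x}" for x
  proof (rule finite_measure_mono; safe?)
    fix \<omega> assume *: "(\<Sum>i\<in>I. a i * Z i \<omega>) \<ge> a K * x" "(\<Sum>i\<in>I. b i * Z i \<omega>) \<ge> b J * x"
    have "y1 * (a K * x) = (1 - b K / b J) * x" "y2 * (b J * x) = x"
      using a(2) b(2) by (simp_all add: y1_def y2_def)
    then have "(2 - b K / b J) * x = y1 * (a K * x) + y2 * (b J * x)"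
      by (simp only:) (simp add: left_diff_distrib)
    also have "\<dots> \<le> y1 * (\<Sum>i\<in>I. a i * Z i \<omega>) + y2 * (\<Sum>i\<in>I. b i * Z i \<omega>)"
      using * y by (intro add_mono mult_left_mono)
    also have "\<dots> = (\<Sum>i\<in>I. c i * Z i \<omega>)"
      by (simp only: c_def sum_distrib_left distrib_right sum.distrib mult.assoc)
    finally show "(\<Sum>i\<in>I. c i * Z i \<omega>) \<ge> (2 - b K / b J) * x" .
  qed measurable
  show ?thesis
    by (intro exI[of _ C] conjI allI C(1) order_trans[OF le C(2)])
qed

section \<open>Quantiles of weighted sums\<close>

text \<open>For nonnegative x take logarithms. Negative x cannot occur: monotonicity would give
  \<open>c \<le> g 0 \<le> g x\<close>, against \<open>g x < e < c\<close>.\<close>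

lemma tail_quantile_lower:
  fixes g :: "real \<Rightarrow> real"
  assumes "antimono g" "\<And>x. x \<ge> 0 \<Longrightarrow> c * exp (- \<theta> * (x / \<alpha>)) \<le> g x"
    and "0 < c" "0 < \<alpha>" "0 < \<theta>" "0 < e" "e < c" "g x < e"
  shows "\<alpha> * ((ln c - ln e) / \<theta>) \<le> x"
proof (cases "x \<ge> 0")
  case True
  then have "c * exp (- \<theta> * (x / \<alpha>)) < e" using assms(2)[of x] assms(8) by simp
  then have "ln (c * exp (- \<theta> * (x / \<alpha>))) < ln e" using assms(3,6) by (subst ln_less_cancel_iff) auto
  then have "ln c - ln e < \<theta> * (x / \<alpha>)" using assms(3,4) by (simp add: ln_mult)
  then have "(ln c - ln e) / \<theta> < x / \<alpha>"
    using assms(5) by (metis pos_divide_less_eq mult.commute)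
  then show ?thesis
    using assms(4) by (metis pos_less_divide_eq mult.commute less_imp_le)
next
  case False
  then have "g 0 \<le> g x" by (intro antimonoD[OF assms(1)]) simp
  then show ?thesis using assms(2)[of 0] assms(7,8) by simp
qed

lemma tail_quantile_upper:
  fixes g :: "real \<Rightarrow> real"
  assumes "g x \<le> C * exp (- \<theta> * (x / \<alpha>))"
    and "0 < C" "0 < \<alpha>" "0 < \<theta>" "0 < e" "\<alpha> * ((ln C - ln e) / \<theta>) < x"
  shows "g x < e"
proof -
  have "(ln C - ln e) / \<theta> < x / \<alpha>"
    using assms(3,6) by (metis pos_less_divide_eq mult.commute)
  then have "ln C - ln e < \<theta> * (x / \<alpha>)"
    using assms(4) by (metis pos_divide_less_eq mult.commute)
  then have "ln (C * exp (- \<theta> * (x / \<alpha>))) < ln e" using assms(2,3) by (simp add: ln_mult)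
  then have "C * exp (- \<theta> * (x / \<alpha>)) < e" using assms(2,5) by (subst (asm) ln_less_cancel_iff) auto
  then show ?thesis using assms(1) by simp
qed

text \<open>Phrased as an implication about \<open>distr_fun\<close>, so that no generalized inverse
  is needed. Dividing by \<open>\<alpha>\<close> brings the weights into [0, 1], as the Chernoff
  bound requires.\<close>

lemma (in prob_space) weighted_sum_quantile_upper:
  assumes I: "finite I" and indep: "indep_vars (\<lambda>_. borel) Z I"
    and a: "\<And>i. i \<in> I \<Longrightarrow> 0 \<le> a i \<and> a i \<le> \<alpha>" "0 < \<alpha>"
    and tail: "\<And>i. i \<in> I \<Longrightarrow> (\<lambda>x. prob {\<omega> \<in> space M. Z i \<omega> > x}) \<in> exp_tail_class \<beta>"
    and "0 < \<theta>" "\<theta> < \<beta>"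
    and X: "X = (\<lambda>\<omega>. \<Sum>i\<in>I. a i * Z i \<omega>)"
  shows "\<exists>k. \<forall>q<1. \<forall>x > \<alpha> * ((k - ln (1 - q)) / \<theta>). distr_fun M X x > q"
proof -
  have Z[measurable]: "\<And>i. i \<in> I \<Longrightarrow> Z i \<in> borel_measurable M"
    using indep by (auto simp: indep_vars_def2)
  have [measurable]: "X \<in> borel_measurable M" unfolding X by measurable
  have c: "0 \<le> a i / \<alpha> \<and> a i / \<alpha> \<le> 1" if "i \<in> I" for i using a that by simp
  obtain C where C: "C > 0"
      "\<And>x. prob {\<omega> \<in> space M. (\<Sum>i\<in>I. a i / \<alpha> * Z i \<omega>) \<ge> x} \<le> C * exp (- \<theta> * x)"
  proof -
    have "\<exists>C>0. \<forall>x. prob {\<omega> \<in> space M. (\<Sum>i\<in>I. a i / \<alpha> * Z i \<omega>) \<ge> x} \<le> C * exp (- \<theta> * x)"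
      by (rule exp_tail_weighted_sum_upper[where \<beta> = \<beta> and c = "\<lambda>i. a i / \<alpha>"]; fact)
    then show ?thesis using that by blast
  qed
  have X': "(\<Sum>i\<in>I. a i / \<alpha> * Z i \<omega>) = X \<omega> / \<alpha>" for \<omega>
    by (simp add: X sum_divide_distrib)
  have le: "prob {\<omega> \<in> space M. X \<omega> > x} \<le> C * exp (- \<theta> * (x / \<alpha>))" for x
  proof -
    have "prob {\<omega> \<in> space M. X \<omega> > x} \<le> prob {\<omega> \<in> space M. X \<omega> / \<alpha> \<ge> x / \<alpha>}"
      using a(2) by (intro finite_measure_mono) (auto simp: divide_right_mono)
    also have "\<dots> \<le> C * exp (- \<theta> * (x / \<alpha>))" using C(2)[of "x / \<alpha>"] unfolding X' .
    finally show ?thesis .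
  qed
  have "distr_fun M X x > q" if "q < 1" "x > \<alpha> * ((ln C - ln (1 - q)) / \<theta>)" for q x
  proof -
    have "prob {\<omega> \<in> space M. X \<omega> > x} < 1 - q"
      using that C(1) a(2) \<open>0 < \<theta>\<close> by (intro tail_quantile_upper[OF le]) auto
    then show ?thesis using one_minus_distr_fun[of X x] by simp
  qed
  then show ?thesis by blast
qed

text \<open>Inverting the tail bound requires \<open>1 - q < c\<close>, hence the restriction to q
  near 1.\<close>

lemma (in prob_space) weighted_sum_quantile_lower:
  assumes I: "finite I" "K \<in> I" and indep: "indep_vars (\<lambda>_. borel) Z I"
    and a: "\<And>i. i \<in> I \<Longrightarrow> 0 \<le> a i" "0 < a K"
    and tail: "\<And>i. i \<in> I \<Longrightarrow> (\<lambda>x. prob {\<omega> \<in> space M. Z i \<omega> > x}) \<in> exp_tail_class \<beta>"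
    and "0 < \<beta>" "\<beta> < \<theta>"
    and X: "X = (\<lambda>\<omega>. \<Sum>i\<in>I. a i * Z i \<omega>)"
  shows "\<exists>k. \<forall>\<^sub>F q in at_left 1. \<forall>x. distr_fun M X x > q \<longrightarrow> x \<ge> a K * ((k - ln (1 - q)) / \<theta>)"
proof -
  have Z[measurable]: "\<And>i. i \<in> I \<Longrightarrow> Z i \<in> borel_measurable M"
    using indep by (auto simp: indep_vars_def2)
  have [measurable]: "X \<in> borel_measurable M" unfolding X by measurable
  obtain c where c: "c > 0"
      "\<And>x. x \<ge> 0 \<Longrightarrow> prob {\<omega> \<in> space M. X \<omega> > x} \<ge> c * exp (- \<theta> * (x / a K))"
  proof -
    have "\<exists>c>0. \<forall>x\<ge>0. prob {\<omega> \<in> space M. (\<Sum>i\<in>I. a i * Z i \<omega>) > x} \<ge> c * exp (- \<theta> * (x / a K))"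
      by (rule weighted_sum_tail_lower[where \<beta> = \<beta> and a = a and K = K]; fact)
    then show ?thesis using that unfolding X by blast
  qed
  have "\<forall>\<^sub>F q in at_left 1. 1 - c < q \<and> q < 1"
    using c(1) by (auto simp: eventually_at_left_field intro: exI[of _ "1 - c"])
  then have "\<forall>\<^sub>F q in at_left 1. \<forall>x. distr_fun M X x > q \<longrightarrow> x \<ge> a K * ((ln c - ln (1 - q)) / \<theta>)"
  proof eventually_elim
    case (elim q)
    show ?case
    proof (intro allI impI)
      fix x assume "distr_fun M X x > q"
      then have "prob {\<omega> \<in> space M. X \<omega> > x} < 1 - q" using one_minus_distr_fun[of X x] by simp
      then show "x \<ge> a K * ((ln c - ln (1 - q)) / \<theta>)"
        by (intro tail_quantile_lower[OF antimono_tail c(2)])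
          (use elim c(1) a(2) \<open>0 < \<beta>\<close> \<open>\<beta> < \<theta>\<close> in auto)
    qed
  qed
  then show ?thesis by blast
qed

section \<open>The residual tail coefficient of two weighted sums\<close>

text \<open>The event defining the coefficient is sandwiched between two joint exceedances, at
  levels \<open>a K * x\<close> and \<open>b J * x\<close> from one side and at
  \<open>a K * x'\<close> and \<open>b J * x'\<close> from the other; the linear program then prices
  both.\<close>

lemma (in prob_space) residual_tail_coeff_weighted_sums:
  assumes I: "finite I" "K \<in> I" "J \<in> I" "K \<noteq> J" and indep: "indep_vars (\<lambda>_. borel) Z I"
    and a: "\<And>i. i \<in> I \<Longrightarrow> 0 \<le> a i \<and> a i \<le> a K" "0 < a K"
    and b: "\<And>i. i \<in> I \<Longrightarrow> 0 \<le> b i \<and> b i \<le> b J" "0 < b J"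
    and ab: "\<And>i. i \<in> I \<Longrightarrow> a i \<noteq> 0 \<Longrightarrow> b i \<le> b K"
    and tail: "\<And>i. i \<in> I \<Longrightarrow> (\<lambda>x. prob {\<omega> \<in> space M. Z i \<omega> > x}) \<in> exp_tail_class \<beta>"
    and "0 < \<beta>"
    and X: "X = (\<lambda>\<omega>. \<Sum>i\<in>I. a i * Z i \<omega>)" and Y: "Y = (\<lambda>\<omega>. \<Sum>i\<in>I. b i * Z i \<omega>)"
  shows "has_residual_tail_coeff M X Y (1 / (2 - b K / b J))"
proof -
  have Z[measurable]: "\<And>i. i \<in> I \<Longrightarrow> Z i \<in> borel_measurable M"
    using indep by (auto simp: indep_vars_def2)
  have X_meas[measurable]: "X \<in> borel_measurable M" unfolding X by measurable
  have Y_meas[measurable]: "Y \<in> borel_measurable M" unfolding Y by measurable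
  have bK: "b K \<le> b J" using b(1) I by auto
  have a0: "\<And>i. i \<in> I \<Longrightarrow> 0 \<le> a i" and b0: "\<And>i. i \<in> I \<Longrightarrow> 0 \<le> b i" using a b by auto
  define \<rho> where "\<rho> = 2 - b K / b J"
  have \<rho>: "\<rho> \<ge> 1" using bK b(2) by (simp add: \<rho>_def)
  define L where "L q = - ln (1 - q)" for q :: real
  have L: "filterlim L at_top (at_left 1)"
    unfolding L_def filterlim_uminus_at_top minus_minus
  proof (rule filterlim_compose[OF ln_at_0], unfold filterlim_at, safe)
    have "((\<lambda>q::real. 1 - q) \<longlongrightarrow> 1 - 1) (at_left 1)" by (intro tendsto_intros)
    then show "((\<lambda>q::real. 1 - q) \<longlongrightarrow> 0) (at_left 1)" by simp
  qed (auto simp: eventually_at_filter)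
  interpret dX: real_distribution "distr M borel X" by (rule real_distribution_distr) fact
  interpret dY: real_distribution "distr M borel Y" by (rule real_distribution_distr) fact
  have [measurable]: "distr_fun M X \<in> borel_measurable borel" "distr_fun M Y \<in> borel_measurable borel"
    by (intro borel_measurable_mono monoI dX.cdf_nondecreasing dY.cdf_nondecreasing; assumption)+
  define E where "E q = {\<omega> \<in> space M. distr_fun M X (X \<omega>) > q \<and> distr_fun M Y (Y \<omega>) > q}" for q
  have E_sets[measurable]: "E q \<in> sets M" for q unfolding E_def by measurable
  define f where "f q = - ln (prob (E q))" for q
  have "((\<lambda>q. f q / L q) \<longlongrightarrow> \<rho>) (at_left 1)"
  proof (rule tendsto_ratio_by_factors[OF L])
    fix s :: real assume s: "0 < s" "s < 1"
    \<comment> \<open>The rates enclose \<open>\<beta>\<close>, and their quotient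
      \<open>\<theta> / \<theta>'\<close> is the factor \<open>s\<^sup>2\<close>.\<close>
    define \<theta> where "\<theta> = \<beta> * s"
    define \<theta>' where "\<theta>' = \<beta> / s"
    have \<theta>: "0 < \<theta>" "\<theta> < \<beta>" "\<beta> < \<theta>'" using s \<open>0 < \<beta>\<close> by (auto simp: \<theta>_def \<theta>'_def field_simps)
    obtain kX where kX: "\<And>q x. q < 1 \<Longrightarrow> x > a K * ((kX + L q) / \<theta>) \<Longrightarrow> distr_fun M X x > q"
    proof -
      have "\<exists>k. \<forall>q<1. \<forall>x > a K * ((k - ln (1 - q)) / \<theta>). distr_fun M X x > q"
        by (rule weighted_sum_quantile_upper[where \<beta> = \<beta> and a = a]; fact)
      then show ?thesis using that unfolding L_def by auto
    qed
    obtain kY where kY: "\<And>q x. q < 1 \<Longrightarrow> x > b J * ((kY + L q) / \<theta>) \<Longrightarrow> distr_fun M Y x > q"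
    proof -
      have "\<exists>k. \<forall>q<1. \<forall>x > b J * ((k - ln (1 - q)) / \<theta>). distr_fun M Y x > q"
        by (rule weighted_sum_quantile_upper[where \<beta> = \<beta> and a = b]; fact)
      then show ?thesis using that unfolding L_def by auto
    qed
    obtain lX where lX: "\<forall>\<^sub>F q in at_left 1. \<forall>x. distr_fun M X x > q \<longrightarrow> x \<ge> a K * ((lX + L q) / \<theta>')"
    proof -
      have "\<exists>k. \<forall>\<^sub>F q in at_left 1. \<forall>x. distr_fun M X x > q \<longrightarrow> x \<ge> a K * ((k - ln (1 - q)) / \<theta>')"
        by (rule weighted_sum_quantile_lower[where \<beta> = \<beta> and a = a and K = K]; fact)
      then show ?thesis using that unfolding L_def by auto
    qed
    obtain lY where lY: "\<forall>\<^sub>F q in at_left 1. \<forall>x. distr_fun M Y x > q \<longrightarrow> x \<ge> b J * ((lY + L q) / \<theta>')"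
    proof -
      have "\<exists>k. \<forall>\<^sub>F q in at_left 1. \<forall>x. distr_fun M Y x > q \<longrightarrow> x \<ge> b J * ((k - ln (1 - q)) / \<theta>')"
        by (rule weighted_sum_quantile_lower[where \<beta> = \<beta> and a = b and K = J]; fact)
      then show ?thesis using that unfolding L_def by auto
    qed
    obtain c where c: "c > 0" "\<And>x. x \<ge> 0 \<Longrightarrow> c * exp (- \<theta>' * (\<rho> * x)) \<le>
        prob {\<omega> \<in> space M. X \<omega> > a K * x \<and> Y \<omega> > b J * x}"
    proof -
      have "\<exists>c>0. \<forall>x\<ge>0. c * exp (- \<theta>' * ((2 - b K / b J) * x)) \<le>
          prob {\<omega> \<in> space M. (\<Sum>i\<in>I. a i * Z i \<omega>) > a K * x \<and> (\<Sum>i\<in>I. b i * Z i \<omega>) > b J * x}"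
        by (rule joint_weighted_tail_lower[where \<beta> = \<beta> and a = a and K = K and b = b and J = J]; fact)
      then show ?thesis using that unfolding X Y \<rho>_def by blast
    qed
    obtain C where C: "C > 0" "\<And>x.
        prob {\<omega> \<in> space M. X \<omega> \<ge> a K * x \<and> Y \<omega> \<ge> b J * x} \<le> C * exp (- \<theta> * (\<rho> * x))"
    proof -
      have "\<exists>C>0. \<forall>x.
          prob {\<omega> \<in> space M. (\<Sum>i\<in>I. a i * Z i \<omega>) \<ge> a K * x \<and> (\<Sum>i\<in>I. b i * Z i \<omega>) \<ge> b J * x} \<le>
          C * exp (- \<theta> * ((2 - b K / b J) * x))"
        by (rule joint_weighted_tail_upper[where \<beta> = \<beta> and a = a and K = K and b = b and J = J]; fact)
      then show ?thesis using that unfolding X Y \<rho>_def by blast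
    qed
    \<comment> \<open>The worse of the two marginal constants, so that one x serves both sums;
      \<open>l\<close> does the same for the other inclusion.\<close>
    define k where "k = max kX kY"
    define l where "l = min lX lY"
    define k' where "k' = max (\<rho> / s\<^sup>2 * k - ln c) (ln C - \<rho> * s\<^sup>2 * l)"
    have "\<forall>\<^sub>F q in at_left 1. L q > - k" using L by (simp add: filterlim_at_top_dense)
    moreover have "\<forall>\<^sub>F q in at_left (1::real). q < 1" by (simp add: eventually_at_filter)
    ultimately have "\<forall>\<^sub>F q in at_left 1. \<rho> * s\<^sup>2 * L q - k' \<le> f q \<and> f q \<le> \<rho> / s\<^sup>2 * L q + k'"
      using lX lY
    proof eventually_elim
      case (elim q)
      define x where "x = (k + L q) / \<theta>"
      define x' where "x' = (l + L q) / \<theta>'"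
      have "x \<ge> 0" using elim \<theta> by (simp add: x_def)
      have "{\<omega> \<in> space M. X \<omega> > a K * x \<and> Y \<omega> > b J * x} \<subseteq> E q"
      proof safe
        fix \<omega> assume *: "\<omega> \<in> space M" "X \<omega> > a K * x" "Y \<omega> > b J * x"
        have "a K * ((kX + L q) / \<theta>) \<le> a K * x" "b J * ((kY + L q) / \<theta>) \<le> b J * x"
          unfolding x_def k_def using a(2) b(2) \<theta>(1)
          by (auto intro!: mult_left_mono divide_right_mono)
        then show "\<omega> \<in> E q" using * kX kY elim(2) unfolding E_def by fastforce
      qed
      then have "c * exp (- \<theta>' * (\<rho> * x)) \<le> prob (E q)"
        using c(2)[OF \<open>x \<ge> 0\<close>] finite_measure_mono[OF _ E_sets] by (meson order_trans)
      moreover have "c * exp (- \<theta>' * (\<rho> * x)) > 0" using c(1) by simp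
      \<comment> \<open>Positivity is recorded here because the second half also takes the logarithm
        of \<open>prob (E q)\<close> and needs it to be monotone there.\<close>
      ultimately have "prob (E q) > 0" and "ln (c * exp (- \<theta>' * (\<rho> * x))) \<le> ln (prob (E q))"
        by (auto simp: ln_mono)
      then have "f q \<le> \<theta>' * (\<rho> * x) - ln c" using c(1) by (simp add: f_def ln_mult)
      also have "\<theta>' * (\<rho> * x) = \<rho> / s\<^sup>2 * (k + L q)"
        using s \<open>0 < \<beta>\<close> by (simp add: x_def \<theta>_def \<theta>'_def power2_eq_square field_simps)
      finally have upper: "f q \<le> \<rho> / s\<^sup>2 * L q + (\<rho> / s\<^sup>2 * k - ln c)" by (simp add: algebra_simps add_divide_distrib)
      have "E q \<subseteq> {\<omega> \<in> space M. X \<omega> \<ge> a K * x' \<and> Y \<omega> \<ge> b J * x'}"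
      proof safe
        fix \<omega> assume *: "\<omega> \<in> E q"
        have "a K * x' \<le> a K * ((lX + L q) / \<theta>')" "b J * x' \<le> b J * ((lY + L q) / \<theta>')"
          unfolding x'_def l_def using a(2) b(2) \<theta>
          by (auto intro!: mult_left_mono divide_right_mono)
        then show "\<omega> \<in> space M" "X \<omega> \<ge> a K * x'" "Y \<omega> \<ge> b J * x'"
          using * elim(3,4) unfolding E_def by (auto intro: order_trans)
      qed
      then have "prob (E q) \<le> C * exp (- \<theta> * (\<rho> * x'))"
        by (intro order_trans[OF finite_measure_mono C(2)]) measurable
      then have "ln (prob (E q)) \<le> ln (C * exp (- \<theta> * (\<rho> * x')))"
        using \<open>prob (E q) > 0\<close> by (simp add: ln_mono)
      then have "\<theta> * (\<rho> * x') - ln C \<le> f q" using C(1) by (simp add: f_def ln_mult)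
      moreover have "\<theta> * (\<rho> * x') = \<rho> * s\<^sup>2 * (l + L q)"
        using s \<open>0 < \<beta>\<close> by (simp add: x'_def \<theta>_def \<theta>'_def power2_eq_square field_simps)
      ultimately have "\<rho> * s\<^sup>2 * L q - (ln C - \<rho> * s\<^sup>2 * l) \<le> f q" by (simp add: algebra_simps)
      with upper show ?case unfolding k'_def by (simp add: max_def)
    qed
    then show "\<exists>k. \<forall>\<^sub>F q in at_left 1. \<rho> * s\<^sup>2 * L q - k \<le> f q \<and> f q \<le> \<rho> / s\<^sup>2 * L q + k" by blast
  qed
  then have "((\<lambda>q. inverse (f q / L q)) \<longlongrightarrow> inverse \<rho>) (at_left 1)"
    using \<rho> by (intro tendsto_inverse) auto
  then show ?thesis
    by (simp add: has_residual_tail_coeff_def f_def L_def E_def \<rho>_def inverse_eq_divide)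
qed

section \<open>Partition nodes and increments\<close>

lemma partition_nodes_mono:
  assumes "is_partition a b m t" "i \<le> m" "j \<le> m"
  shows "t i < t j \<longleftrightarrow> i < j" "t i \<le> t j \<longleftrightarrow> i \<le> j"
  using assms strict_mono_on_less[of "{..m}" t i j] strict_mono_on_less_eq[of "{..m}" t i j]
  by (auto simp: is_partition_def)

text \<open>Replaces the maximum by an order equivalence. The assumption \<open>a \<le> s\<close>
  puts node 0 into the set, so that the maximum is attained.\<close>

lemma le_last_node_iff:
  assumes t: "is_partition a b m t" and "a \<le> s" "i \<le> m"
  shows "i \<le> last_node m t s \<longleftrightarrow> t i \<le> s" and "last_node m t s \<le> m"
proof -
  define A where "A = {i. i \<le> m \<and> t i \<le> s}"
  have A: "finite A" "0 \<in> A" using assms by (auto simp: A_def is_partition_def)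
  have "Max A \<in> A" using A by (intro Max_in) auto
  then have M: "last_node m t s \<le> m" "t (last_node m t s) \<le> s"
    by (auto simp: last_node_def A_def)
  then show "last_node m t s \<le> m" by simp
  show "i \<le> last_node m t s \<longleftrightarrow> t i \<le> s"
  proof
    assume "i \<le> last_node m t s"
    then have "t i \<le> t (last_node m t s)" using partition_nodes_mono(2)[OF t \<open>i \<le> m\<close> M(1)] by simp
    then show "t i \<le> s" using M(2) by simp
  next
    assume "t i \<le> s"
    then have "i \<in> A" using \<open>i \<le> m\<close> by (simp add: A_def)
    then show "i \<le> last_node m t s" using A(1) by (simp add: last_node_def flip: A_def)
  qed
qed

lemma dense_nodes_in_interval:
  fixes t :: "nat \<Rightarrow> nat \<Rightarrow> real"
  assumes dense: "\<forall>s \<in> {..T}. \<exists>a :: nat \<Rightarrow> real.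
      (\<forall>n. - real n < s1 \<longrightarrow> a n \<in> t n ` {..m n}) \<and> (\<lambda>n. \<bar>a n - s\<bar>) \<longlonglongrightarrow> 0"
    and "x < y" "x < T"
  shows "\<forall>\<^sub>F n in sequentially. \<exists>i\<le>m n. x < t n i \<and> t n i < y"
proof -
  \<comment> \<open>A target strictly inside the interval and not beyond \<open>T\<close>, so that
    the density hypothesis applies to it.\<close>
  define z where "z = (x + min y T) / 2"
  have z: "x < z" "z < y" "z \<le> T" using assms by (auto simp: z_def)
  then obtain a where a: "\<And>n. - real n < s1 \<Longrightarrow> a n \<in> t n ` {..m n}" "(\<lambda>n. \<bar>a n - z\<bar>) \<longlonglongrightarrow> 0"
    using dense by force
  have "a \<longlonglongrightarrow> z" using a(2) by (simp add: tendsto_rabs_zero_iff LIM_zero_iff)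
  then have "\<forall>\<^sub>F n in sequentially. x < a n" "\<forall>\<^sub>F n in sequentially. a n < y"
    using z by (auto dest: order_tendstoD)
  moreover have "\<forall>\<^sub>F n in sequentially. - real n < s1"
    using eventually_gt_at_top[of "nat \<lceil>- s1\<rceil>"] by eventually_elim linarith
  ultimately show ?thesis
  proof eventually_elim
    case (elim n)
    then show ?case using a(1)[of n] by auto
  qed
qed

lemma has_residual_tail_coeff_imp_eq:
  assumes "has_residual_tail_coeff P X Y \<eta>"
  shows "residual_tail_coeff P X Y = \<eta>"
  unfolding residual_tail_coeff_def
  using assms by (intro the_equality) (auto simp: has_residual_tail_coeff_def
      intro: tendsto_unique[OF trivial_limit_at_left_real])

lemma indep_vars_partition_increments:
  assumes "prob_space P" and M: "indep_scattered_random_measure P {..T} M"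
    and t: "is_partition a T m t"
  shows "prob_space.indep_vars P (\<lambda>_. borel) (\<lambda>i. M {t i..<t (Suc i)}) {..<m}"
    and "i < m \<Longrightarrow> {t i..<t (Suc i)} \<in> bounded_borel {..T}"
proof -
  interpret prob_space P by fact
  show cell: "{t i..<t (Suc i)} \<in> bounded_borel {..T}" if "i < m" for i
  proof -
    have "t (Suc i) \<le> t m" using partition_nodes_mono(2)[OF t, of "Suc i" m] that by simp
    then show ?thesis using t by (auto simp: bounded_borel_def is_partition_def)
  qed
  \<comment> \<open>Independent scattering is stated for infinite sequences of sets, so the finite
    partition is padded with empty sets.\<close>
  define B where "B i = (if i < m then {t i..<t (Suc i)} else {})" for i
  have "range B \<subseteq> bounded_borel {..T}"
    using cell by (auto simp: B_def) (auto simp: bounded_borel_def)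
  moreover have "disjoint_family B"
    unfolding disjoint_family_on_def
  proof (intro ballI impI)
    have disj: "B i \<inter> B j = {}" if "i < j" for i j
    proof (cases "j < m")
      case True
      then have "t (Suc i) \<le> t j" using partition_nodes_mono(2)[OF t, of "Suc i" j] that by simp
      then show ?thesis by (auto simp: B_def)
    qed (simp add: B_def)
    fix i j :: nat assume "i \<noteq> j"
    then show "B i \<inter> B j = {}" using disj[of i j] disj[of j i] by (cases "i < j") auto
  qed
  ultimately have "indep_vars (\<lambda>_. borel) (\<lambda>i. M (B i)) UNIV"
    using M by (simp add: indep_scattered_random_measure_def)
  then have "indep_vars (\<lambda>_. borel) (\<lambda>i. M (B i)) {..<m}" by (rule indep_vars_subset) simp
  then show "indep_vars (\<lambda>_. borel) (\<lambda>i. M {t i..<t (Suc i)}) {..<m}"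
    by (rule indep_vars_cong[THEN iffD1, rotated -1]) (auto simp: B_def)
qed

section \<open>The coefficient of the integral approximations and its limit\<close>

text \<open>A decreasing kernel puts the largest coefficient on the last cell, whose left endpoint
  has index one below the last node. Every cell in the first sum starts no later than that sum's
  last cell, so its coefficient in the second sum is dominated as the linear program
  requires.\<close>

lemma residual_tail_coeff_integral_approx:
  assumes P: "prob_space P" and M: "indep_scattered_random_measure P {..T} M"
    and G: "\<forall>x\<ge>0. G x \<ge> 0" "strict_antimono_on {0..} G" and "0 < \<beta>"
    and tail: "\<forall>B \<in> bounded_borel {..T}. emeasure lborel B > 0 \<longrightarrow>
      (\<lambda>x. 1 - distr_fun P (M B) x) \<in> exp_tail_class \<beta>"
    and t: "is_partition a T m t" and "a \<le> s1" "s1 \<le> s2"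
    and n1: "0 < last_node m t s1" and n12: "last_node m t s1 < last_node m t s2"
  shows "has_residual_tail_coeff P (integral_approx M G m t s1) (integral_approx M G m t s2)
    (1 / (2 - G (s2 - t (last_node m t s1 - 1)) / G (s2 - t (last_node m t s2 - 1))))"
proof -
  interpret prob_space P by fact
  define n1 where "n1 = last_node m t s1"
  define n2 where "n2 = last_node m t s2"
  have n: "0 < n1" "n1 < n2" using assms by (auto simp: n1_def n2_def)
  have "a \<le> s2" using assms by simp
  note last1 = le_last_node_iff[OF t \<open>a \<le> s1\<close>, folded n1_def]
  note last2 = le_last_node_iff[OF t \<open>a \<le> s2\<close>, folded n2_def]
  have nm: "n2 \<le> m" using last2(2)[of 0] by simp
  have t1: "t i \<le> s1" if "i < n1" for i using last1(1)[of i] that n nm by simp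
  have t2: "t i \<le> s2" if "i < n2" for i using last2(1)[of i] that nm by simp
  have G_mono: "G y \<le> G x" if "0 \<le> x" "x \<le> y" for x y
    using monotone_onD[OF G(2), of x y] that by (cases "x = y") auto
  \<comment> \<open>A strictly decreasing function that is nonnegative at x + 1 is positive at
    x.\<close>
  have G_pos: "0 < G x" if "0 \<le> x" for x
  proof -
    have "G (x + 1) < G x" using monotone_onD[OF G(2), of x "x + 1"] that by auto
    then show ?thesis using G(1)[rule_format, of "x + 1"] that by simp
  qed
  define I where "I = {..<n2}"
  define Z where "Z i = M {t i..<t (Suc i)}" for i
  \<comment> \<open>Zero padding lets both sums run over the same increments, those of the second
    one.\<close>
  define c1 where "c1 i = (if i < n1 then G (s1 - t i) else 0)" for i
  define c2 where "c2 i = G (s2 - t i)" for i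
  have t_mono: "t i \<le> t j" if "i \<le> j" "j < n2" for i j
    using partition_nodes_mono(2)[OF t, of i j] that nm by simp
  have indep: "indep_vars (\<lambda>_. borel) Z I"
    unfolding Z_def I_def using nm
    by (intro indep_vars_subset[OF indep_vars_partition_increments(1)[OF P M t]]) auto
  have "has_residual_tail_coeff P (\<lambda>\<omega>. \<Sum>i\<in>I. c1 i * Z i \<omega>) (\<lambda>\<omega>. \<Sum>i\<in>I. c2 i * Z i \<omega>)
    (1 / (2 - c2 (n1 - 1) / c2 (n2 - 1)))"
  proof (rule residual_tail_coeff_weighted_sums[where a = c1 and b = c2 and K = "n1 - 1" and J = "n2 - 1",
        OF _ _ _ _ indep _ _ _ _ _ _ \<open>0 < \<beta>\<close> refl refl])
    show "finite I" "n1 - 1 \<in> I" "n2 - 1 \<in> I" "n1 - 1 \<noteq> n2 - 1" using n by (auto simp: I_def)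
    show "0 < c1 (n1 - 1)" using n t1[of "n1 - 1"] by (simp add: c1_def G_pos)
    show "0 < c2 (n2 - 1)" using n t2[of "n2 - 1"] by (simp add: c2_def G_pos)
    fix i assume i: "i \<in> I"
    show "0 \<le> c1 i \<and> c1 i \<le> c1 (n1 - 1)"
      using n t1[of i] t1[of "n1 - 1"] t_mono[of i "n1 - 1"] G_pos[of "s1 - t i"]
        G_pos[of "s1 - t (n1 - 1)"] G_mono[of "s1 - t (n1 - 1)" "s1 - t i"]
      by (cases "i < n1") (simp_all add: c1_def)
    show "0 \<le> c2 i \<and> c2 i \<le> c2 (n2 - 1)"
      using i n t2[of i] t2[of "n2 - 1"] t_mono[of i "n2 - 1"] G_pos[of "s2 - t i"]
        G_mono[of "s2 - t (n2 - 1)" "s2 - t i"]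
      by (simp add: c2_def I_def)
    show "c2 i \<le> c2 (n1 - 1)" if "c1 i \<noteq> 0"
      using that n t2[of "n1 - 1"] t_mono[of i "n1 - 1"] G_mono[of "s2 - t (n1 - 1)" "s2 - t i"]
      by (simp add: c1_def c2_def split: if_splits)
    have im: "i < m" using i nm by (simp add: I_def)
    then have "t i < t (Suc i)" using partition_nodes_mono(1)[OF t, of i "Suc i"] by simp
    then have "(\<lambda>x. 1 - distr_fun P (Z i) x) \<in> exp_tail_class \<beta>"
      unfolding Z_def using im
      by (intro tail[rule_format] indep_vars_partition_increments(2)[OF P M t]) auto
    moreover have "Z i \<in> borel_measurable P" using indep i by (auto simp: indep_vars_def2)
    ultimately show "(\<lambda>x. prob {\<omega> \<in> space P. Z i \<omega> > x}) \<in> exp_tail_class \<beta>"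
      by (simp add: one_minus_distr_fun)
  qed
  moreover have "(\<Sum>i\<in>I. c1 i * Z i \<omega>) = integral_approx M G m t s1 \<omega>" for \<omega>
  proof -
    have "(\<Sum>i\<in>I. c1 i * Z i \<omega>) = (\<Sum>i<n1. c1 i * Z i \<omega>)"
      using n by (intro sum.mono_neutral_right) (auto simp: I_def c1_def)
    then show ?thesis by (simp add: integral_approx_def c1_def Z_def flip: n1_def)
  qed
  moreover have "(\<Sum>i\<in>I. c2 i * Z i \<omega>) = integral_approx M G m t s2 \<omega>" for \<omega>
    by (simp add: integral_approx_def c2_def Z_def I_def flip: n2_def)
  ultimately show ?thesis by (simp add: c2_def n1_def n2_def)
qed

text \<open>The relevant node is the one before the last, so two nodes are found between y and s:
  the later one bounds the last node from below, the earlier one its predecessor.\<close>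

lemma penultimate_node_tendsto:
  fixes t :: "nat \<Rightarrow> nat \<Rightarrow> real"
  assumes dense: "\<forall>s \<in> {..T}. \<exists>a :: nat \<Rightarrow> real.
      (\<forall>n. - real n < s1 \<longrightarrow> a n \<in> t n ` {..m n}) \<and> (\<lambda>n. \<bar>a n - s\<bar>) \<longlonglongrightarrow> 0"
    and t: "\<forall>n. - real n < s1 \<longrightarrow> is_partition (- real n) T (m n) (t n)"
    and s: "s1 \<le> s" "s \<le> T"
  shows "\<forall>\<^sub>F n in sequentially. 0 < last_node (m n) (t n) s \<and> t n (last_node (m n) (t n) s - 1) \<le> s"
    and "(\<lambda>n. t n (last_node (m n) (t n) s - 1)) \<longlonglongrightarrow> s"
proof -
  define N where "N n = last_node (m n) (t n) s" for n
  have n_large: "\<forall>\<^sub>F n in sequentially. - real n < s1"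
    using eventually_gt_at_top[of "nat \<lceil>- s1\<rceil>"] by eventually_elim linarith
  have close: "\<forall>\<^sub>F n in sequentially. 0 < N n \<and> y < t n (N n - 1) \<and> t n (N n - 1) \<le> s" if "y < s" for y
  proof -
    define z where "z = (y + s) / 2"
    have z: "y < z" "z < s" using that by (auto simp: z_def)
    have "\<forall>\<^sub>F n in sequentially. \<exists>i\<le>m n. y < t n i \<and> t n i < z"
      using z s by (intro dense_nodes_in_interval[OF dense]) auto
    moreover have "\<forall>\<^sub>F n in sequentially. \<exists>i\<le>m n. z < t n i \<and> t n i < s"
      using z s by (intro dense_nodes_in_interval[OF dense]) auto
    ultimately show ?thesis using n_large
    proof eventually_elim
      case (elim n)
      then have tn: "is_partition (- real n) T (m n) (t n)" and ns: "- real n \<le> s" using t s by auto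
      from elim obtain i j where i: "i \<le> m n" "y < t n i" "t n i < z"
        and j: "j \<le> m n" "z < t n j" "t n j < s" by blast
      note last = le_last_node_iff[OF tn ns, folded N_def]
      have "i < j" using partition_nodes_mono(1)[OF tn i(1) j(1)] i j by linarith
      moreover have "j \<le> N n" using last(1)[OF j(1)] j by simp
      ultimately have N: "i \<le> N n - 1" "0 < N n" by auto
      have "N n \<le> m n" using last(2)[OF i(1)] .
      then have "t n i \<le> t n (N n - 1)" "t n (N n - 1) \<le> s"
        using partition_nodes_mono(2)[OF tn i(1), of "N n - 1"] last(1)[of "N n - 1"] N by auto
      then show ?case using i N by simp
    qed
  qed
  show "\<forall>\<^sub>F n in sequentially. 0 < last_node (m n) (t n) s \<and> t n (last_node (m n) (t n) s - 1) \<le> s"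
    using close[of "s - 1"] by (auto simp: N_def elim: eventually_mono)
  show "(\<lambda>n. t n (last_node (m n) (t n) s - 1)) \<longlonglongrightarrow> s"
    unfolding N_def[symmetric]
  proof (rule order_tendstoI)
    fix y assume "y < s"
    from close[OF this] show "\<forall>\<^sub>F n in sequentially. y < t n (N n - 1)"
      by (rule eventually_mono) simp
  next
    fix y assume "s < y"
    from close[of "s - 1"] show "\<forall>\<^sub>F n in sequentially. t n (N n - 1) < y"
      by (rule eventually_mono) (use \<open>s < y\<close> in auto)
  qed
qed

theorem theorem4p2:
  fixes P :: "'a measure"
    and M :: "real set \<Rightarrow> 'a \<Rightarrow> real"
    and G :: "real \<Rightarrow> real"
    and u :: "real \<Rightarrow> 'a \<Rightarrow> real"
    and T \<beta> s1 s2 h :: real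
    and m :: "nat \<Rightarrow> nat"
    and t :: "nat \<Rightarrow> nat \<Rightarrow> real"
    and u_approx :: "nat \<Rightarrow> real \<Rightarrow> 'a \<Rightarrow> real"
  assumes "prob_space P"
    and "indep_scattered_random_measure P {..T} M"
    and "moving_average P {..T} M G u"
    and "\<forall>x\<ge>0. G x \<ge> 0" and "continuous_on {0..} G" and "strict_antimono_on {0..} G"
    and "\<beta> > 0"
    and "\<forall>B \<in> bounded_borel {..T}. emeasure lborel B > 0 \<longrightarrow>
           absolutely_continuous lborel (distr P borel (M B)) \<and>
           (\<lambda>x. 1 - distr_fun P (M B) x) \<in> exp_tail_class \<beta>"
    and "s1 < s2" and "s2 \<le> T" and "h = \<bar>s1 - s2\<bar>"
    and "\<forall>n. - real n < s1 \<longrightarrow> is_partition (- real n) T (m n) (t n)"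
    and "\<forall>n. - real n < s1 \<longrightarrow> u_approx n = integral_approx M G (m n) (t n)"
    and "filterlim m at_top sequentially"
    and "\<forall>s \<in> {..T}. \<exists>a :: nat \<Rightarrow> real. (\<forall>n. - real n < s1 \<longrightarrow> a n \<in> t n ` {..m n}) \<and>
           (\<lambda>n. \<bar>a n - s\<bar>) \<longlonglongrightarrow> 0"
  shows "(\<forall>\<^sub>F n in sequentially.
            \<exists>\<eta>. has_residual_tail_coeff P (u_approx n s1) (u_approx n s2) \<eta>) \<and>
         (\<lambda>n. residual_tail_coeff P (u_approx n s1) (u_approx n s2)) \<longlonglongrightarrow> 1 / (2 - G h / G 0)"
proof -
  note G = assms(4-6)
  note t = assms(12) and dense = assms(15)
  have h: "h = s2 - s1" "h > 0" using assms(9,11) by auto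
  define N1 where "N1 n = last_node (m n) (t n) s1" for n
  define N2 where "N2 n = last_node (m n) (t n) s2" for n
  define \<eta> where "\<eta> n = 1 / (2 - G (s2 - t n (N1 n - 1)) / G (s2 - t n (N2 n - 1)))" for n
  note node1 = penultimate_node_tendsto[OF dense t order.refl, folded N1_def]
  note node2 = penultimate_node_tendsto[OF dense t _ \<open>s2 \<le> T\<close>, folded N2_def]
  have s12: "s1 \<le> s2" "s1 \<le> T" using assms(9,10) by auto
  have "\<forall>\<^sub>F n in sequentially. - real n < s1"
    using eventually_gt_at_top[of "nat \<lceil>- s1\<rceil>"] by eventually_elim linarith
  \<comment> \<open>Such a node is counted by \<open>N2 n\<close> but not by \<open>N1 n\<close>,
    which separates the final cells of the two sums.\<close>
  moreover have "\<forall>\<^sub>F n in sequentially. \<exists>i\<le>m n. s1 < t n i \<and> t n i < s2"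
    using assms(9,10) by (intro dense_nodes_in_interval[OF dense]) auto
  ultimately have coeff: "\<forall>\<^sub>F n in sequentially.
      has_residual_tail_coeff P (u_approx n s1) (u_approx n s2) (\<eta> n)"
    using node1(1)[OF s12(2)]
  proof eventually_elim
    case (elim n)
    then have tn: "is_partition (- real n) T (m n) (t n)"
      and u: "u_approx n = integral_approx M G (m n) (t n)" using t assms(13) by auto
    from elim obtain i where i: "i \<le> m n" "s1 < t n i" "t n i < s2" by blast
    have "\<not> i \<le> N1 n" "i \<le> N2 n"
      using le_last_node_iff(1)[OF tn _ i(1)] i elim s12 by (auto simp: N1_def N2_def)
    then have "N1 n < N2 n" by simp
    then show ?case
      unfolding u \<eta>_def N1_def N2_def using elim s12 assms(8)
      by (intro residual_tail_coeff_integral_approx[OF assms(1,2) G(1,3) assms(7) _ tn])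
        (auto simp: N1_def N2_def)
  qed
  \<comment> \<open>\<open>G\<close> is continuous on the half-line only; the nodes stay to the left
    of \<open>s2\<close>, so the arguments never leave it.\<close>
  have "(\<lambda>n. G (s2 - t n (N1 n - 1))) \<longlonglongrightarrow> G (s2 - s1)"
  proof (rule continuous_on_tendsto_compose[OF G(2)])
    show "(\<lambda>n. s2 - t n (N1 n - 1)) \<longlonglongrightarrow> s2 - s1"
      by (intro tendsto_intros node1(2) s12)
    show "\<forall>\<^sub>F n in sequentially. s2 - t n (N1 n - 1) \<in> {0..}"
      using node1(1)[OF s12(2)] by (rule eventually_mono) (use s12 in auto)
  qed (use s12 in auto)
  moreover have "(\<lambda>n. G (s2 - t n (N2 n - 1))) \<longlonglongrightarrow> G 0"
  proof (rule continuous_on_tendsto_compose[OF G(2)])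
    have "(\<lambda>n. s2 - t n (N2 n - 1)) \<longlonglongrightarrow> s2 - s2"
      by (intro tendsto_intros node2(2) s12)
    then show "(\<lambda>n. s2 - t n (N2 n - 1)) \<longlonglongrightarrow> 0" by simp
    show "\<forall>\<^sub>F n in sequentially. s2 - t n (N2 n - 1) \<in> {0..}"
      using node2(1)[OF s12(1)] by (rule eventually_mono) auto
  qed auto
  \<comment> \<open>This keeps both denominators of the limit away from 0: the quotient
    \<open>G h / G 0\<close> is less than 1.\<close>
  moreover have "G h < G 0" "0 \<le> G h" using monotone_onD[OF G(3), of 0 h] G(1) h by auto
  then have "G 0 \<noteq> 0" "2 - G h / G 0 \<noteq> 0" by (auto simp: field_simps)
  ultimately have \<eta>: "\<eta> \<longlonglongrightarrow> 1 / (2 - G h / G 0)"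
    unfolding \<eta>_def[abs_def] h(1) by (intro tendsto_intros) auto
  have "\<forall>\<^sub>F n in sequentially. residual_tail_coeff P (u_approx n s1) (u_approx n s2) = \<eta> n"
    using coeff by (rule eventually_mono) (rule has_residual_tail_coeff_imp_eq)
  then have "(\<lambda>n. residual_tail_coeff P (u_approx n s1) (u_approx n s2)) \<longlonglongrightarrow> 1 / (2 - G h / G 0)"
    by (rule tendsto_cong[THEN iffD2, OF _ \<eta>])
  with coeff show ?thesis by (auto elim: eventually_mono)
qed

end
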